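(* Let $T\subseteq X_0$ be a generalised nice set with $\langle P_{\{1,2,1\}}\rangle\subseteq T$. Then: (i) If $|T\cap X_E|=2$, then $|T\cap X|\in\{2,4,6,10\}$; more precisely: if $|T\cap X|=2$ then $T\cap X=\{\{1,2\},\{1,5\}\}$; if $|T\cap X|=4$ then $T\cap X=\{\{1,2\},\{1,k\},\{1,5\},\{1,k*1\}\}$ for some $k\in\{3,4,6,7\}$; if $|T\cap X|=6$ then $T\cap X=X_{(1)}=\{\{1,l\}:l=2,\dots,7\}$; if $|T\cap X|=10$ then $T\cap X$ equals $T_{(1,j,k)}$ or $T_{(1,j*k,k)}$ for some $j\in\{2,5\}$ and $k\in\{3,4,6,7\}$. (ii) If $|T\cap X_E|>2$, then $|T\cap X|\in\{3,15,21\}$; more precisely: if $|T\cap X|=3$ then $T\cap X=X_{\ell_{12}}$; if $|T\cap X|=15$ then there is $s\in I\setminus\{1\}$ with $T\cap X=X\setminus X_{\ell_{1s}^C}$; if $|T\cap X|=21$ then $T\cap X=X$.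
   Context: Let $I=\{1,\dots,7\}$ and $I_0=I\cup\{0\}$. The Fano plane on $I$ has the seven lines $\{1,2,5\},\{5,6,7\},\{1,4,7\},\{1,3,6\},\{2,4,6\},\{2,3,7\},\{3,4,5\}$. For distinct $i,j\in I$, $i*j$ is the third point of the unique line containing $i$ and $j$, and $\ell_{ij}=\{i,j,i*j\}$. The operation is extended to $I_0$ by $0*i=i*0=i$ and $i*i=0$ for all $i\in I_0$. Three pairwise distinct $i,j,k\in I$ are generative if $k\neq i*j$. Let $X_0$ be the set of unordered pairs $\{i,j\}$ with $i,j\in I_0$, where $i=j$ is allowed; $X=\{\{i,j\}:i,j\in I,\ i\neq j\}$, $X_E=\{\{i,i\}:i\in I_0\}$. For a line $\ell$, $X_\ell=\{\{i,j\}\in X:i,j\in\ell\}$ and $X_{\ell^C}=\{\{i,j\}\in X:i,j\notin\ell\}$; for $i\in I$, $X_{(i)}=\{\{i,j\}\in X: j\neq i\}$. For $i,j,k\in I_0$ let $P_{\{i,j,k\}}=\{\{i,j\},\{j,k\},\{k,i\},\{i,j*k\},\{j,k*i\},\{k,i*j\}\}\subseteq X_0$. For generative $i,j,k\in I$, $T_{(i,j,k)}=P_{\{i,j,k\}}\cup\{\{i,i*j\},\{i,i*k\},\{i*j,i*k\},\{i,i*j*k\}\}$. A subset $T\subseteq X_0$ is a generalised nice set if for all $i,j,k\in I_0$, $\{i,j\}\in T$ and $\{i*j,k\}\in T$ imply $P_{\{i,j,k\}}\subseteq T$. For $S\subseteq X_0$, $\langle S\rangle$ denotes the smallest generalised nice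 set containing $S$. *)

theory Defs
  imports Main
begin

text \<open>An unordered pair is encoded as the set \<open>{i, j}\<close>; the degenerate pair \<open>{i, i}\<close>
  is then the singleton \<open>{i}\<close>.\<close>

definition idx :: "nat set" where
  "idx = {1..7}"

definition idx0 :: "nat set" where
  "idx0 = idx \<union> {0}"

definition fano_lines :: "nat set set" where
  "fano_lines = {{1,2,5}, {5,6,7}, {1,4,7}, {1,3,6}, {2,4,6}, {2,3,7}, {3,4,5}}"

text \<open>Only the values of \<open>fano_op\<close> on \<open>idx0\<close> are meaningful.\<close>

definition fano_op :: "nat \<Rightarrow> nat \<Rightarrow> nat" (infixl "\<star>" 70) where
  "i \<star> j =
    (if i = 0 then j
     else if j = 0 then i
     else if i = j then 0
     else (THE k. k \<noteq> i \<and> k \<noteq> j \<and> {i, j, k} \<in> fano_lines))"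

definition line_through :: "nat \<Rightarrow> nat \<Rightarrow> nat set" where
  "line_through i j = {i, j, i \<star> j}"

definition X0 :: "nat set set" where
  "X0 = {{i, j} | i j. i \<in> idx0 \<and> j \<in> idx0}"

definition X :: "nat set set" where
  "X = {{i, j} | i j. i \<in> idx \<and> j \<in> idx \<and> i \<noteq> j}"

definition XE :: "nat set set" where
  "XE = {{i, i} | i. i \<in> idx0}"

definition X_line :: "nat set \<Rightarrow> nat set set" where
  "X_line l = {{i, j} | i j. {i, j} \<in> X \<and> i \<in> l \<and> j \<in> l}"

definition X_line_compl :: "nat set \<Rightarrow> nat set set" where
  "X_line_compl l = {{i, j} | i j. {i, j} \<in> X \<and> i \<notin> l \<and> j \<notin> l}"

definition X_point :: "nat \<Rightarrow> nat set set" where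
  "X_point i = {{i, j} | j. {i, j} \<in> X \<and> j \<noteq> i}"

definition P_set :: "nat \<Rightarrow> nat \<Rightarrow> nat \<Rightarrow> nat set set" where
  "P_set i j k =
    {{i, j}, {j, k}, {k, i}, {i, j \<star> k}, {j, k \<star> i}, {k, i \<star> j}}"

text \<open>\<open>T_set i j k\<close> is intended for generative \<open>i, j, k\<close>, i.e. pairwise distinct points
  of \<open>idx\<close> with \<open>k \<noteq> i \<star> j\<close>.\<close>

definition T_set :: "nat \<Rightarrow> nat \<Rightarrow> nat \<Rightarrow> nat set set" where
  "T_set i j k =
    P_set i j k \<union> {{i, i \<star> j}, {i, i \<star> k}, {i \<star> j, i \<star> k}, {i, i \<star> j \<star> k}}"

definition gen_nice :: "nat set set \<Rightarrow> bool" where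
  "gen_nice T \<longleftrightarrow> T \<subseteq> X0 \<and>
    (\<forall>i\<in>idx0. \<forall>j\<in>idx0. \<forall>k\<in>idx0.
      {i, j} \<in> T \<longrightarrow> {i \<star> j, k} \<in> T \<longrightarrow> P_set i j k \<subseteq> T)"

text \<open>For \<open>S \<subseteq> X0\<close> the intersected family contains \<open>X0\<close> and is closed under intersection,
  so this is the smallest generalised nice set containing \<open>S\<close>.\<close>

definition gen_nice_hull :: "nat set set \<Rightarrow> nat set set" where
  "gen_nice_hull S = \<Inter> {T. gen_nice T \<and> S \<subseteq> T}"

end

theory Submission
  imports Defs
begin

text \<open>The operation turns \<open>idx0\<close> into an elementary abelian group of order 8, in which
  \<open>insert 0 (line_through x y)\<close> is a subgroup of index 2. If \<open>T\<close> is nice and contains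
  \<open>P_set x y x\<close>, index 2 forces \<open>{0, i \<star> j}\<close>, and then \<open>{x, i \<star> j}\<close>, into \<open>T\<close> for each
  \<open>{i, j}\<close> in \<open>T\<close>, so that niceness allows translating the entries of a pair by \<open>x\<close>: \<open>T\<close> is
  the preimage of a set of unordered pairs in the quotient by \<open>{0, x}\<close>, a Klein four-group.
  Its nonzero elements are the three lines through \<open>x\<close>. An edge between two of them forces the
  edges from \<open>0\<close> to all three; two edges at one line produce a loop there; and a loop is joined
  to everything that \<open>0\<close> is joined to. Hence without loops there is at most one edge, and in the
  presence of a loop there are zero, two or three of them.\<close>

section \<open>The Fano plane as an elementary abelian group\<close>

declare One_nat_def [simp del]

lemma fano_line_unique:
  assumes "l \<in> fano_lines" "m \<in> fano_lines" "i \<in> l" "j \<in> l" "i \<in> m" "j \<in> m" "i \<noteq> j"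
  shows "l = m"
proof -
  have "\<forall>l\<in>fano_lines. \<forall>m\<in>fano_lines. l \<noteq> m \<longrightarrow> (\<forall>i\<in>l \<inter> m. \<forall>j\<in>l \<inter> m. i = j)"
    unfolding fano_lines_def by simp
  then show ?thesis
    using assms by blast
qed

lemma fano_op_eqI:
  assumes line: "{i, j, k} \<in> fano_lines" and points: "0 \<notin> {i, j, k}" "distinct [i, j, k]"
  shows "i \<star> j = k"
proof -
  have "k' = k" if "k' \<noteq> i" "k' \<noteq> j" "{i, j, k'} \<in> fano_lines" for k'
  proof -
    have "{i, j, k'} = {i, j, k}"
      using that line points by (intro fano_line_unique[of _ _ i j]) simp_all
    then show ?thesis
      using that by blast
  qed
  then have "(THE k. k \<noteq> i \<and> k \<noteq> j \<and> {i, j, k} \<in> fano_lines) = k"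
    using line points by (intro the_equality) auto
  then show ?thesis
    unfolding fano_op_def using points by simp
qed

lemma fano_op_0 [simp]: "0 \<star> i = i" "i \<star> 0 = i" and fano_op_self [simp]: "i \<star> i = 0"
  by (simp_all add: fano_op_def)

lemma fano_op_line:
  assumes "{i, j, k} \<in> fano_lines" "0 \<notin> {i, j, k}" "distinct [i, j, k]"
  shows "i \<star> j = k" "j \<star> i = k" "i \<star> k = j" "k \<star> i = j" "j \<star> k = i" "k \<star> j = i"
  by (rule fano_op_eqI; use assms in \<open>simp add: insert_commute\<close>)+

lemma fano_lines_mem:
  "{1, 2, 5} \<in> fano_lines" "{5, 6, 7} \<in> fano_lines" "{1, 4, 7} \<in> fano_lines"
  "{1, 3, 6} \<in> fano_lines" "{2, 4, 6} \<in> fano_lines" "{2, 3, 7} \<in> fano_lines"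
  "{3, 4, 5} \<in> fano_lines"
  unfolding fano_lines_def by simp_all

lemma fano_op_table:
  "1 \<star> 2 = 5" "1 \<star> 3 = 6" "1 \<star> 4 = 7" "1 \<star> 5 = 2" "1 \<star> 6 = 3" "1 \<star> 7 = 4"
  "2 \<star> 1 = 5" "2 \<star> 3 = 7" "2 \<star> 4 = 6" "2 \<star> 5 = 1" "2 \<star> 6 = 4" "2 \<star> 7 = 3"
  "3 \<star> 1 = 6" "3 \<star> 2 = 7" "3 \<star> 4 = 5" "3 \<star> 5 = 4" "3 \<star> 6 = 1" "3 \<star> 7 = 2"
  "4 \<star> 1 = 7" "4 \<star> 2 = 6" "4 \<star> 3 = 5" "4 \<star> 5 = 3" "4 \<star> 6 = 2" "4 \<star> 7 = 1"
  "5 \<star> 1 = 2" "5 \<star> 2 = 1" "5 \<star> 3 = 4" "5 \<star> 4 = 3" "5 \<star> 6 = 7" "5 \<star> 7 = 6"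
  "6 \<star> 1 = 3" "6 \<star> 2 = 4" "6 \<star> 3 = 1" "6 \<star> 4 = 2" "6 \<star> 5 = 7" "6 \<star> 7 = 5"
  "7 \<star> 1 = 4" "7 \<star> 2 = 3" "7 \<star> 3 = 2" "7 \<star> 4 = 1" "7 \<star> 5 = 6" "7 \<star> 6 = 5"
  by (simp_all add: fano_lines_mem[THEN fano_op_line(1)] fano_lines_mem[THEN fano_op_line(2)]
      fano_lines_mem[THEN fano_op_line(3)] fano_lines_mem[THEN fano_op_line(4)]
      fano_lines_mem[THEN fano_op_line(5)] fano_lines_mem[THEN fano_op_line(6)])

lemma idx_eq: "idx = {1, 2, 3, 4, 5, 6, 7}"
  unfolding idx_def by auto

lemma idx0_eq: "idx0 = insert 0 idx"
  unfolding idx0_def by simp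

lemma mem_idx0_if_mem_idx [simp]: "i \<in> idx \<Longrightarrow> i \<in> idx0"
  by (simp add: idx0_eq)

lemma zero_mem_idx0 [simp]: "0 \<in> idx0" and finite_idx0 [simp]: "finite idx0"
  by (simp_all add: idx0_eq idx_eq)

lemma finite_idx [simp]: "finite idx" and card_idx: "card idx = 7"
  and zero_notin_idx [simp]: "0 \<notin> idx"
  by (simp_all add: idx_def)

lemma card_idx0: "card idx0 = 8"
  by (simp add: idx0_eq card_idx)

lemma fano_op_mem_idx0 [simp]:
  assumes "i \<in> idx0" "j \<in> idx0"
  shows "i \<star> j \<in> idx0"
proof -
  have "\<forall>i\<in>idx0. \<forall>j\<in>idx0. i \<star> j \<in> idx0"
    by (simp add: idx0_eq idx_eq fano_op_table)
  then show ?thesis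
    using assms by blast
qed

lemma fano_op_commute:
  assumes "i \<in> idx0" "j \<in> idx0"
  shows "i \<star> j = j \<star> i"
proof -
  have "\<forall>i\<in>idx0. \<forall>j\<in>idx0. i \<star> j = j \<star> i"
    by (simp add: idx0_eq idx_eq fano_op_table)
  then show ?thesis
    using assms by blast
qed

lemma fano_op_assoc:
  assumes "i \<in> idx0" "j \<in> idx0" "k \<in> idx0"
  shows "i \<star> j \<star> k = i \<star> (j \<star> k)"
proof -
  have "\<forall>i\<in>idx0. \<forall>j\<in>idx0. \<forall>k\<in>idx0. i \<star> j \<star> k = i \<star> (j \<star> k)"
    by (simp add: idx0_eq idx_eq fano_op_table)
  then show ?thesis
    using assms by blast
qed

lemma fano_op_cancel_left:
  assumes "i \<in> idx0" "j \<in> idx0"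
  shows "i \<star> (i \<star> j) = j"
  using assms by (simp flip: fano_op_assoc)

lemma fano_op_left_cancel:
  assumes "i \<in> idx0" "j \<in> idx0" "k \<in> idx0"
  shows "i \<star> j = i \<star> k \<longleftrightarrow> j = k"
  using fano_op_cancel_left assms by metis

lemma line_through_distinct:
  assumes "i \<in> idx" "j \<in> idx" "i \<noteq> j"
  shows "i \<star> j \<noteq> 0" "i \<star> j \<noteq> i" "i \<star> j \<noteq> j"
  using assms fano_op_left_cancel[of i j i] fano_op_left_cancel[of i j 0]
    fano_op_left_cancel[of j i 0] fano_op_commute[of i j]
  by (auto simp: idx0_eq idx_def)

lemma line_through_subset_idx:
  assumes "i \<in> idx" "j \<in> idx" "i \<noteq> j"
  shows "line_through i j \<subseteq> idx"
  using assms line_through_distinct(1)[OF assms] fano_op_mem_idx0[of i j]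
  unfolding line_through_def by (simp add: idx0_eq)

lemma card_line_through:
  assumes "i \<in> idx" "j \<in> idx" "i \<noteq> j"
  shows "card (line_through i j) = 3"
  using assms line_through_distinct[OF assms] unfolding line_through_def by auto

definition generative :: "nat \<Rightarrow> nat \<Rightarrow> nat \<Rightarrow> bool" where
  "generative i j k \<longleftrightarrow> {i, j, k} \<subseteq> idx \<and> distinct [i, j, k] \<and> k \<noteq> i \<star> j"

lemma generative_idx:
  assumes "generative i j k"
  shows "i \<in> idx" "j \<in> idx" "k \<in> idx"
  using assms unfolding generative_def by auto

lemma generative_iff:
  assumes "i \<in> idx" "j \<in> idx" "i \<noteq> j"
  shows "generative i j k \<longleftrightarrow> k \<in> idx - line_through i j"
  using assms unfolding generative_def line_through_def by auto

lemma generative_distinct: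
  assumes "generative i j k"
  shows "distinct [0, i, j, i \<star> j, k, i \<star> k, j \<star> k, i \<star> (j \<star> k)]"
proof -
  have "\<forall>i\<in>idx. \<forall>j\<in>idx. \<forall>k\<in>idx. distinct [i, j, k] \<longrightarrow> k \<noteq> i \<star> j \<longrightarrow>
      distinct [0, i, j, i \<star> j, k, i \<star> k, j \<star> k, i \<star> (j \<star> k)]"
    by (simp add: idx_eq fano_op_table)
  then show ?thesis
    using assms unfolding generative_def by blast
qed

lemma generative_idx_eq:
  assumes "generative i j k"
  shows "idx = {i, j, i \<star> j, k, i \<star> k, j \<star> k, i \<star> (j \<star> k)}"
proof -
  let ?points = "[i, j, i \<star> j, k, i \<star> k, j \<star> k, i \<star> (j \<star> k)]"
  note distinct = generative_distinct[OF assms]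
  have "card (set (0 # ?points)) = card idx0"
    using distinct_card[OF distinct] by (simp add: card_idx0)
  then have "insert 0 (set ?points) = insert 0 idx"
    using generative_idx[OF assms] card_subset_eq[of idx0 "set (0 # ?points)"]
    by (simp flip: idx0_eq)
  moreover have "0 \<notin> set ?points"
    using distinct by (simp only: distinct.simps not_False_eq_True)
  ultimately have "idx = set ?points"
    using insert_ident zero_notin_idx by metis
  then show ?thesis
    by simp
qed

lemma generative_idx_Diff:
  assumes "generative i j k"
  shows "idx - {i} = {j, i \<star> j, k, i \<star> k, j \<star> k, i \<star> (j \<star> k)}"
  by (subst generative_idx_eq[OF assms], subst Diff_insert_absorb[symmetric])
    (use generative_distinct[OF assms] in simp_all)

lemma generative_swap:
  assumes "generative i j k"
  shows "generative i k j"
  using generative_distinct[OF assms] generative_idx[OF assms] by (auto simp: generative_def)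

lemma fano_op_mem_line_through:
  assumes "generative x y i" "generative x y j"
  shows "i \<star> j \<in> insert 0 (line_through x y)"
proof -
  note idx = generative_idx[OF assms(1)]
  have "j \<in> {i, x \<star> i, y \<star> i, x \<star> (y \<star> i)}"
    using assms(2) generative_idx_eq[OF assms(1)] unfolding generative_def by auto
  moreover have "i \<star> (h \<star> i) = h" if "h \<in> idx0" for h
    using that idx fano_op_commute[of h i] by (simp add: fano_op_cancel_left)
  ultimately show ?thesis
    using idx unfolding line_through_def by (auto simp: fano_op_assoc[symmetric, of x y i])
qed

section \<open>Sets of pairs\<close>

lemma X_eq: "X = {p. p \<subseteq> idx \<and> card p = 2}"
  unfolding X_def card_2_iff by blast

lemma pair_mem_X_iff: "{i, j} \<in> X \<longleftrightarrow> i \<in> idx \<and> j \<in> idx \<and> i \<noteq> j"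
  unfolding X_def by (auto simp: doubleton_eq_iff)

lemma X_cases:
  assumes "p \<in> X" "x \<in> idx"
  obtains (point) k where "k \<in> idx - {x}" "p = {x, k}"
  | (collinear) s where "s \<in> idx - {x}" "p = {s, x \<star> s}"
  | (crossing) i j where "generative x i j" "p = {i, j}"
proof -
  obtain i j where p_eq: "p = {i, j}" "i \<in> idx" "j \<in> idx" "i \<noteq> j"
    using assms(1) unfolding X_def by blast
  then consider "i = x" | "j = x" | "j = x \<star> i" "i \<noteq> x" | "generative x i j"
    using assms(2) unfolding generative_def by auto
  then show ?thesis
    using p_eq point collinear crossing by cases (auto simp: insert_commute)
qed

lemma card_X: "card X = 21"
  unfolding X_eq by (subst n_subsets) (simp_all add: card_idx choose_two)

lemma X_point_eq:
  assumes "i \<in> idx"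
  shows "X_point i = (\<lambda>l. {i, l}) ` (idx - {i})"
  using assms unfolding X_point_def pair_mem_X_iff by blast

lemma card_image_pair: "card ((\<lambda>k. {i, k}) ` A) = card A"
  by (intro card_image) (auto simp: inj_on_def doubleton_eq_iff)

lemma card_X_point:
  assumes "i \<in> idx"
  shows "card (X_point i) = 6"
  using assms by (simp add: X_point_eq card_image_pair card_idx)

lemma X_line_line_through:
  assumes "i \<in> idx" "j \<in> idx" "i \<noteq> j"
  shows "X_line (line_through i j) = {{i, j}, {i, i \<star> j}, {j, i \<star> j}}"
  using assms line_through_distinct[OF assms] line_through_subset_idx[OF assms]
  unfolding X_line_def pair_mem_X_iff line_through_def by auto

lemma card_X_line:
  assumes "i \<in> idx" "j \<in> idx" "i \<noteq> j"
  shows "card (X_line (line_through i j)) = 3"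
  using assms(3) line_through_distinct[OF assms]
  by (auto simp: X_line_line_through[OF assms] doubleton_eq_iff card_insert_if)

lemma X_line_compl_eq: "X_line_compl l = {p. p \<subseteq> idx - l \<and> card p = 2}"
  unfolding X_line_compl_def X_eq card_2_iff by blast

lemma card_X_Diff_X_line_compl:
  assumes "i \<in> idx" "j \<in> idx" "i \<noteq> j"
  shows "card (X - X_line_compl (line_through i j)) = 15"
proof -
  have "card (idx - line_through i j) = 4"
    using line_through_subset_idx[OF assms] finite_subset[OF _ finite_idx]
    by (simp add: card_Diff_subset card_line_through[OF assms] card_idx)
  then have "card (X_line_compl (line_through i j)) = 6"
    unfolding X_line_compl_eq by (simp add: n_subsets choose_two)
  moreover have "X_line_compl (line_through i j) \<subseteq> X"
    unfolding X_line_compl_def by blast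
  ultimately show ?thesis
    using card_X by (simp add: card_Diff_subset card_ge_0_finite)
qed

lemma T_set_eq:
  assumes "generative i j k"
  shows "T_set i j k = X_point i \<union> {{j, k}, {j, i \<star> k}, {i \<star> j, k}, {i \<star> j, i \<star> k}}"
proof -
  have points: "i \<in> idx0" "j \<in> idx0" "k \<in> idx0"
    using generative_idx[OF assms] by simp_all
  have "X_point i = {{i, j}, {i, i \<star> j}, {i, k}, {i, i \<star> k}, {i, j \<star> k}, {i, i \<star> (j \<star> k)}}"
    using generative_idx[OF assms] by (simp add: X_point_eq generative_idx_Diff[OF assms])
  moreover have "{k, i} = {i, k}" "{k, i \<star> j} = {i \<star> j, k}"
    by auto
  ultimately show ?thesis
    unfolding T_set_def P_set_def fano_op_assoc[OF points] fano_op_commute[OF points(3,1)]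
    by (simp only: Un_insert_left Un_empty_left insert_commute insert_absorb2)
qed

lemma T_set_subset_X:
  assumes "generative i j k"
  shows "T_set i j k \<subseteq> X"
proof -
  have "{j, i \<star> j, k, i \<star> k} \<subseteq> idx"
    using generative_idx_Diff[OF assms] by blast
  moreover have "X_point i \<subseteq> X"
    unfolding X_point_def by blast
  ultimately show ?thesis
    using generative_distinct[OF assms] by (simp add: T_set_eq[OF assms] pair_mem_X_iff)
qed

lemma card_T_set:
  assumes "generative i j k"
  shows "card (T_set i j k) = 10"
proof -
  let ?block = "{{j, k}, {j, i \<star> k}, {i \<star> j, k}, {i \<star> j, i \<star> k}}"
  have "card ?block = 4"
    using generative_distinct[OF assms] by (simp add: doubleton_eq_iff)
  moreover have "X_point i \<inter> ?block = {}"
    using generative_distinct[OF assms] by (auto simp: X_point_def doubleton_eq_iff)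
  moreover have "card (X_point i) = 6"
    using card_X_point generative_idx(1)[OF assms] .
  moreover have "finite (X_point i)"
    by (rule card_ge_0_finite) (simp add: \<open>card (X_point i) = 6\<close>)
  ultimately show ?thesis
    unfolding T_set_eq[OF assms] by (subst card_Un_disjoint) simp_all
qed

lemma T_set_swap:
  assumes "generative i j k"
  shows "T_set i j k = T_set i k j"
  unfolding T_set_eq[OF assms] T_set_eq[OF generative_swap[OF assms]]
  by (auto simp: insert_commute)

lemma T_set_normal_form:
  assumes xy: "x \<in> idx" "y \<in> idx" "x \<noteq> y" and ij: "generative x i j"
  shows "\<exists>r\<in>{y, x \<star> y}. \<exists>k\<in>idx - line_through x y.
    T_set x i j = T_set x r k \<or> T_set x i j = T_set x (r \<star> k) k"
proof -
  note idx = generative_idx[OF ij]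
  have off_line: "k \<in> idx - line_through x y" if "generative x r k" "r \<in> {y, x \<star> y}" for r k
    using that xy fano_op_cancel_left[of x y] unfolding generative_def line_through_def by auto
  have distinct: "i \<noteq> x" "j \<noteq> x" "i \<star> j \<noteq> 0" "i \<star> j \<noteq> x"
    using generative_distinct[OF ij] by auto
  consider (left) "i \<in> line_through x y" | (right) "j \<in> line_through x y"
    | (product) "generative x y i" "generative x y j"
    using idx generative_iff[OF xy] by blast
  then show ?thesis
  proof cases
    case left
    then have "i \<in> {y, x \<star> y}"
      using distinct unfolding line_through_def by blast
    then show ?thesis
      using off_line[OF ij] by blast
  next
    case right
    then have "j \<in> {y, x \<star> y}"
      using distinct unfolding line_through_def by blast
    then show ?thesis
      using off_line[OF generative_swap[OF ij]] T_set_swap[OF ij] by blast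
  next
    case product
    then have "i \<star> j \<in> {y, x \<star> y}"
      using fano_op_mem_line_through[OF product] distinct unfolding line_through_def by blast
    moreover have "i \<star> j \<star> j = i"
      using idx by (simp add: fano_op_assoc)
    moreover have "j \<in> idx - line_through x y"
      using product(2) generative_iff[OF xy] by blast
    ultimately show ?thesis
      by metis
  qed
qed

section \<open>Generalised nice sets\<close>

lemma gen_nice_mem_idx0:
  assumes "gen_nice T" "{i, j} \<in> T"
  shows "i \<in> idx0" "j \<in> idx0"
proof -
  have "{i, j} \<in> X0"
    using assms unfolding gen_nice_def by blast
  then show "i \<in> idx0" "j \<in> idx0"
    unfolding X0_def by (auto simp: doubleton_eq_iff)
qed

lemma gen_niceD:
  assumes "gen_nice T" "{i, j} \<in> T" "{i \<star> j, k} \<in> T"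
  shows "{j, k} \<in> T" "{i, k} \<in> T" "{i, j \<star> k} \<in> T"
proof -
  have "P_set i j k \<subseteq> T"
    using assms gen_nice_mem_idx0[OF assms(1,2)] gen_nice_mem_idx0[OF assms(1,3)]
    unfolding gen_nice_def by blast
  then show "{j, k} \<in> T" "{i, k} \<in> T" "{i, j \<star> k} \<in> T"
    unfolding P_set_def by (auto simp: insert_commute)
qed

lemma gen_nice_loopD:
  assumes "gen_nice T" "{s} \<in> T" "{0, k} \<in> T"
  shows "{s, k} \<in> T"
  using gen_niceD(1)[of T s s k] assms by simp

lemma gen_nice_loopI:
  assumes "gen_nice T" "{s, k} \<in> T" "{s, s \<star> k} \<in> T"
  shows "{s} \<in> T"
  using gen_niceD(2)[of T s k s] assms by (simp add: insert_commute)

lemma subset_gen_nice_hull: "S \<subseteq> gen_nice_hull S"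
  unfolding gen_nice_hull_def by blast

locale gen_nice_above_P =
  fixes T :: "nat set set" and x y :: nat
  assumes nice: "gen_nice T"
    and x_idx [simp]: "x \<in> idx" and y_idx [simp]: "y \<in> idx" and x_neq_y: "x \<noteq> y"
    and P_subset: "P_set x y x \<subseteq> T"
begin

lemmas niceD = gen_niceD[OF nice]
lemmas mem_idx0 = gen_nice_mem_idx0[OF nice]
lemmas loopD = gen_nice_loopD[OF nice]
lemmas loopI = gen_nice_loopI[OF nice]
lemmas xy_distinct = line_through_distinct[OF x_idx y_idx x_neq_y]
lemmas generative_xy_iff = generative_iff[OF x_idx y_idx x_neq_y]

lemma base_mem:
  "{0} \<in> T" "{x} \<in> T" "{0, x} \<in> T" "{0, y} \<in> T" "{0, x \<star> y} \<in> T" "{x, y} \<in> T"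
  "{x, x \<star> y} \<in> T"
proof -
  show "{x} \<in> T" and xy: "{x, y} \<in> T" and y0: "{0, y} \<in> T" and "{x, x \<star> y} \<in> T"
    using P_subset unfolding P_set_def by (auto simp: insert_commute)
  show x0: "{0, x} \<in> T"
    using niceD(2)[of 0 y x] y0 xy by (simp add: insert_commute)
  show "{0} \<in> T"
    using niceD(3)[of 0 x x] x0 \<open>{x} \<in> T\<close> by simp
  show "{0, x \<star> y} \<in> T"
    using niceD(3)[of 0 x y] x0 xy by simp
qed

lemma mem_0_iff_mem_x: "{0, k} \<in> T \<longleftrightarrow> {x, k} \<in> T"
proof
  show "{0, k} \<in> T \<Longrightarrow> {x, k} \<in> T"
    using loopD base_mem(2) .
  show "{x, k} \<in> T \<Longrightarrow> {0, k} \<in> T"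
    using niceD(2)[of 0 x k] base_mem(3) by simp
qed

lemma mem_0_op:
  assumes "{i, j} \<in> T"
  shows "{0, i \<star> j} \<in> T"
proof -
  let ?H = "insert 0 (line_through x y)"
  have mem_0: "{0, h} \<in> T" if "h \<in> ?H" for h
    using that base_mem unfolding line_through_def by auto
  have mem_0_op_left: "{0, h \<star> k} \<in> T" if "h \<in> ?H" "{h, k} \<in> T" for h k
    using niceD(3)[of 0 h k] mem_0 that by simp
  have points: "i \<in> idx0" "j \<in> idx0"
    using mem_idx0[OF assms] .
  have "generative x y k" if "k \<in> idx0" "k \<notin> ?H" for k
    using that generative_xy_iff unfolding idx0_eq by blast
  then consider (left) "i \<in> ?H" | (right) "j \<in> ?H" | (product) "i \<star> j \<in> ?H"
    using fano_op_mem_line_through points by blast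
  then show ?thesis
  proof cases
    case left
    then show ?thesis
      using mem_0_op_left assms by blast
  next
    case right
    then show ?thesis
      using mem_0_op_left[of j i] assms fano_op_commute[OF points] by (simp add: insert_commute)
  next
    case product
    then show ?thesis
      by (rule mem_0)
  qed
qed

lemma mem_0_left:
  assumes "{i, j} \<in> T"
  shows "{0, i} \<in> T"
  using niceD(2)[OF assms, of x] mem_0_op[OF assms]
  by (simp add: mem_0_iff_mem_x insert_commute)

lemma mem_0_right:
  assumes "{i, j} \<in> T"
  shows "{0, j} \<in> T"
  using mem_0_left[of j i] assms by (simp add: insert_commute)

lemma mem_x_op_right_iff:
  assumes "j \<in> idx0"
  shows "{i, x \<star> j} \<in> T \<longleftrightarrow> {i, j} \<in> T"
proof -
  have translate: "{i, x \<star> k} \<in> T" if "{i, k} \<in> T" for k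
    using niceD(3)[OF that, of x] mem_0_op[OF that] mem_idx0(2)[OF that]
    by (simp add: mem_0_iff_mem_x insert_commute fano_op_commute)
  show ?thesis
    using translate[of j] translate[of "x \<star> j"] assms by (auto simp: fano_op_cancel_left)
qed

lemma mem_x_op_left_iff:
  assumes "i \<in> idx0"
  shows "{x \<star> i, j} \<in> T \<longleftrightarrow> {i, j} \<in> T"
  using mem_x_op_right_iff[OF assms, of j] by (simp add: insert_commute)

lemma loop_x_op_iff:
  assumes "s \<in> idx0"
  shows "{s, x \<star> s} \<in> T \<longleftrightarrow> {s} \<in> T" "{x \<star> s} \<in> T \<longleftrightarrow> {s} \<in> T"
  using mem_x_op_right_iff[OF assms, of s] mem_x_op_left_iff[OF assms, of "x \<star> s"] by simp_all

lemma mem_0_of_crossing: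
  assumes "generative x i j" "{i, j} \<in> T" "k \<in> idx0"
  shows "{0, k} \<in> T"
proof -
  have "{0, i} \<in> T" "{0, j} \<in> T" "{0, i \<star> j} \<in> T"
    using mem_0_left mem_0_right mem_0_op assms(2) by blast+
  moreover have "k \<in> {0, x, i, x \<star> i, j, x \<star> j, i \<star> j, x \<star> (i \<star> j)}"
    using assms(3) generative_idx_eq[OF assms(1)] unfolding idx0_eq by blast
  ultimately show ?thesis
    using generative_idx[OF assms(1)] base_mem(1,3) by (auto simp: mem_x_op_right_iff)
qed

definition loop_free :: bool where
  "loop_free \<longleftrightarrow> (\<forall>s\<in>idx - {x}. {s} \<notin> T)"

definition crossing_free :: bool where
  "crossing_free \<longleftrightarrow> (\<forall>i j. generative x i j \<longrightarrow> {i, j} \<notin> T)"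

definition support :: "nat set" where
  "support = {k \<in> idx - {x}. {0, k} \<in> T}"

lemma support_cases:
  obtains (line) "support = {y, x \<star> y}"
  | (two_lines) k where "generative x y k" "support = {y, x \<star> y, k, x \<star> k}"
  | (all) "support = idx - {x}"
proof (cases "\<exists>k\<in>support. generative x y k")
  case False
  then have "support \<subseteq> line_through x y - {x}"
    using generative_xy_iff unfolding support_def by blast
  then have "support = {y, x \<star> y}"
    using base_mem(4,5) line_through_subset_idx[OF x_idx y_idx x_neq_y] x_neq_y xy_distinct
    unfolding support_def line_through_def by auto
  then show ?thesis
    by (rule line)
next
  case True
  then obtain k where k_support: "generative x y k" "{0, k} \<in> T"
    unfolding support_def by blast
  note idx = generative_idx[OF k_support(1)] and points = generative_idx_Diff[OF k_support(1)]
  have mem: "{0, y} \<in> T" "{0, x \<star> y} \<in> T" "{0, k} \<in> T" "{0, x \<star> k} \<in> T"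
    "{0, x \<star> (y \<star> k)} \<in> T \<longleftrightarrow> {0, y \<star> k} \<in> T"
    using k_support(2) base_mem idx by (simp_all add: mem_x_op_right_iff)
  show ?thesis
  proof (cases "{0, y \<star> k} \<in> T")
    case True
    then have "support = idx - {x}"
      using mem unfolding support_def points by auto
    then show ?thesis
      by (rule all)
  next
    case False
    then have "support = {y, x \<star> y, k, x \<star> k}"
      using mem unfolding support_def points by auto
    then show ?thesis
      by (rule two_lines[OF k_support(1)])
  qed
qed

lemma Int_X_point_eq: "T \<inter> X_point x = (\<lambda>k. {x, k}) ` support"
  unfolding X_point_eq[OF x_idx] support_def by (auto simp: mem_0_iff_mem_x)

lemma Int_X_loop_free_cases:
  assumes "loop_free" "p \<in> T \<inter> X"
  obtains (point) "p \<in> X_point x" | (crossing) i j where "generative x i j" "p = {i, j}"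
proof -
  have "p \<in> X"
    using assms(2) ..
  from this x_idx show ?thesis
  proof (cases rule: X_cases)
    case (point k)
    then show ?thesis
      using that(1) by (simp add: X_point_eq)
  next
    case (collinear s)
    then show ?thesis
      using assms by (auto simp: loop_free_def loop_x_op_iff)
  next
    case (crossing i j)
    then show ?thesis
      by (rule that(2))
  qed
qed

lemma Int_X_eq_Int_X_point:
  assumes "loop_free" "crossing_free"
  shows "T \<inter> X = T \<inter> X_point x"
proof -
  have "p \<in> X_point x" if "p \<in> T \<inter> X" for p
    using assms(1) that
  proof (cases rule: Int_X_loop_free_cases)
    case point
    then show ?thesis .
  next
    case (crossing i j)
    then show ?thesis
      using that assms(2) unfolding crossing_free_def by blast
  qed
  moreover have "X_point x \<subseteq> X"
    unfolding X_point_def by blast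
  ultimately show ?thesis
    by blast
qed

lemma T_set_subset_of_crossing:
  assumes "generative x i j" "{i, j} \<in> T"
  shows "T_set x i j \<subseteq> T"
proof -
  have "X_point x \<subseteq> T"
    using mem_0_of_crossing[OF assms] by (auto simp: X_point_def mem_0_iff_mem_x pair_mem_X_iff)
  then show ?thesis
    using assms(2) generative_idx[OF assms(1)]
    by (simp add: T_set_eq[OF assms(1)] mem_x_op_right_iff mem_x_op_left_iff)
qed

lemma crossing_mem_T_set:
  assumes loop_free: "loop_free"
    and ij: "generative x i j" "{i, j} \<in> T"
    and ab: "generative x a b" "{a, b} \<in> T"
  shows "{a, b} \<in> T_set x i j"
proof -
  note idx = generative_idx[OF ij(1)] and points = generative_idx_Diff[OF ij(1)]
  have no_loop: "{i} \<notin> T" "{j} \<notin> T" "{i \<star> j} \<notin> T"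
    using loop_free points unfolding loop_free_def by blast+
  have i_ij: "{i, i \<star> j} \<notin> T"
    using loopI[OF ij(2)] no_loop(1) by blast
  have j_ij: "{j, i \<star> j} \<notin> T"
    using loopI[of j i] ij(2) no_loop(2) idx
    by (auto simp: insert_commute fano_op_commute)
  have representative: "\<exists>r\<in>{i, j, i \<star> j}. c = r \<or> c = x \<star> r" if "c \<in> idx - {x}" for c
    using that unfolding points by blast
  have "a \<in> idx - {x}" "b \<in> idx - {x}"
    using ab(1) unfolding generative_def by auto
  then obtain r s where r_rep: "r \<in> {i, j, i \<star> j}" "a = r \<or> a = x \<star> r"
    and s_rep: "s \<in> {i, j, i \<star> j}" "b = s \<or> b = x \<star> s"
    using representative by metis
  have "r \<in> idx0" "s \<in> idx0"
    using r_rep(1) s_rep(1) idx by auto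
  then have "{r, s} \<in> T"
    using ab(2) r_rep(2) s_rep(2) by (auto simp: mem_x_op_right_iff mem_x_op_left_iff)
  then have "r = i \<and> s = j \<or> r = j \<and> s = i"
    using r_rep(1) s_rep(1) no_loop i_ij j_ij by (auto simp: insert_commute)
  then show ?thesis
    using r_rep(2) s_rep(2) by (auto simp: T_set_eq[OF ij(1)] doubleton_eq_iff)
qed

lemma Int_X_eq_T_set:
  assumes loop_free: "loop_free" and ij: "generative x i j" "{i, j} \<in> T"
  shows "T \<inter> X = T_set x i j"
proof
  show "T_set x i j \<subseteq> T \<inter> X"
    using T_set_subset_of_crossing T_set_subset_X ij by blast
  show "T \<inter> X \<subseteq> T_set x i j"
  proof
    fix p
    assume "p \<in> T \<inter> X"
    with loop_free show "p \<in> T_set x i j"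
    proof (cases rule: Int_X_loop_free_cases)
      case point
      then show ?thesis
        by (simp add: T_set_eq[OF ij(1)])
    next
      case (crossing a b)
      then show ?thesis
        using \<open>p \<in> T \<inter> X\<close> crossing_mem_T_set[OF loop_free ij] by blast
    qed
  qed
qed

lemma Int_X_eq_X_line:
  assumes loop: "{y} \<in> T" and crossing_free: "crossing_free"
  shows "T \<inter> X = X_line (line_through x y)"
proof -
  have line: "k \<in> line_through x y" if "{0, k} \<in> T" "k \<in> idx" for k
    using loopD[OF loop that(1)] crossing_free that(2) generative_xy_iff
    unfolding crossing_free_def by blast
  have "T \<inter> X \<subseteq> X_line (line_through x y)"
    using line mem_0_left mem_0_right unfolding X_line_def X_def by blast
  moreover have "X_line (line_through x y) \<subseteq> T"
    using base_mem loop
    by (simp add: X_line_line_through[OF x_idx y_idx x_neq_y] loop_x_op_iff)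
  moreover have "X_line (line_through x y) \<subseteq> X"
    unfolding X_line_def by blast
  ultimately show ?thesis
    by blast
qed

lemma X_Diff_X_line_compl_subset:
  assumes loop: "{s} \<in> T" "s \<in> idx" and all: "\<And>k. k \<in> idx \<Longrightarrow> {0, k} \<in> T"
  shows "X - X_line_compl (line_through x s) \<subseteq> T"
proof -
  have line: "{h, k} \<in> T" if "h \<in> line_through x s" "k \<in> idx" for h k
  proof -
    have "{h} \<in> T"
      using that(1) loop base_mem(2) unfolding line_through_def by (auto simp: loop_x_op_iff)
    then show ?thesis
      using loopD all that(2) by blast
  qed
  then have "{k, h} \<in> T" if "h \<in> line_through x s" "k \<in> idx" for h k
    using that by (simp add: insert_commute)
  with line show ?thesis
    unfolding X_line_compl_def X_def by blast
qed

lemma loop_of_pair_off_line: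
  assumes loop: "{s} \<in> T" and all: "\<And>k. k \<in> idx \<Longrightarrow> {0, k} \<in> T"
    and off: "generative x s j" "generative x s k" "j \<noteq> k" "{j, k} \<in> T"
    and "l \<in> idx"
  shows "{l} \<in> T"
proof -
  note idx = generative_idx[OF off(1)]
  note translate = mem_x_op_right_iff loop_x_op_iff
  have s_pairs: "{s, j} \<in> T" "{s, s \<star> j} \<in> T"
    using loopD[OF loop] all idx generative_idx_eq[OF off(1)] by auto
  have "k \<in> {x \<star> j, s \<star> j, x \<star> (s \<star> j)}"
    using off(2,3) generative_idx_eq[OF off(1)] unfolding generative_def by auto
  then have j_sj: "{j, s \<star> j} \<in> T"
    using off(4) idx loopD[of j "s \<star> j"] mem_0_right[OF s_pairs(2)]
    by (auto simp: translate)
  have "{j} \<in> T"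
    using loopI[of j s] s_pairs(1) j_sj idx fano_op_commute[of s j]
    by (simp add: insert_commute)
  moreover have "{s \<star> j} \<in> T"
    using loopI[of "s \<star> j" s] s_pairs(2) j_sj idx fano_op_commute[of "s \<star> j" s]
    by (simp add: insert_commute fano_op_cancel_left)
  moreover have "l \<in> {x, s, x \<star> s, j, x \<star> j, s \<star> j, x \<star> (s \<star> j)}"
    using \<open>l \<in> idx\<close> generative_idx_eq[OF off(1)] by blast
  ultimately show ?thesis
    using loop base_mem(2) idx by (auto simp: translate)
qed

lemma Int_X_cases_loop_crossing:
  assumes loop: "s \<in> idx - {x}" "{s} \<in> T" and crossing: "generative x i j" "{i, j} \<in> T"
  obtains (meeting) "T \<inter> X = X - X_line_compl (line_through x s)" | (all) "T \<inter> X = X"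
proof (cases "T \<inter> X_line_compl (line_through x s) = {}")
  case True
  then have "T \<inter> X = X - X_line_compl (line_through x s)"
    using X_Diff_X_line_compl_subset[OF loop(2)] loop(1) mem_0_of_crossing[OF crossing] by auto
  then show ?thesis
    by (rule meeting)
next
  case False
  then obtain j k where jk: "{j, k} \<in> T" "{j, k} \<in> X"
      "j \<notin> line_through x s" "k \<notin> line_through x s"
    unfolding X_line_compl_def by blast
  then have "generative x s j" "generative x s k" "j \<noteq> k"
    using loop(1) by (auto simp: generative_iff pair_mem_X_iff)
  then have "{l} \<in> T" if "l \<in> idx" for l
    using loop_of_pair_off_line[OF loop(2)] mem_0_of_crossing[OF crossing] jk(1) that by simp
  then have "{a, b} \<in> T" if "a \<in> idx" "b \<in> idx" for a b
    using loopD mem_0_of_crossing[OF crossing] that by simp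
  then have "T \<inter> X = X"
    unfolding X_def by blast
  then show ?thesis
    by (rule all)
qed

lemma Int_X_cases_loop_free:
  assumes loop_free: "loop_free"
  obtains (line) "card (T \<inter> X) = 2" "T \<inter> X = {{x, y}, {x, x \<star> y}}"
  | (two_lines) "card (T \<inter> X) = 4"
      "\<exists>k\<in>idx - line_through x y. T \<inter> X = {{x, y}, {x, k}, {x, x \<star> y}, {x, k \<star> x}}"
  | (point) "card (T \<inter> X) = 6" "T \<inter> X = X_point x"
  | (crossing) "card (T \<inter> X) = 10"
      "\<exists>r\<in>{y, x \<star> y}. \<exists>k\<in>idx - line_through x y.
        T \<inter> X = T_set x r k \<or> T \<inter> X = T_set x (r \<star> k) k"
proof (cases "crossing_free")
  case False
  then obtain i j where ij: "generative x i j" "{i, j} \<in> T"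
    unfolding crossing_free_def by blast
  have "T \<inter> X = T_set x i j"
    using Int_X_eq_T_set loop_free ij by blast
  then show ?thesis
    using crossing T_set_normal_form[OF x_idx y_idx x_neq_y ij(1)] card_T_set[OF ij(1)] by simp
next
  case True
  then have Int_X_eq: "T \<inter> X = (\<lambda>k. {x, k}) ` support"
    using Int_X_eq_Int_X_point[OF loop_free] Int_X_point_eq by simp
  then have card_Int_X: "card (T \<inter> X) = card support"
    by (simp add: card_image_pair)
  show ?thesis
  proof (cases rule: support_cases)
    case line
    then show ?thesis
      using that(1) xy_distinct Int_X_eq card_Int_X by simp
  next
    case (two_lines k)
    have "card {y, x \<star> y, k, x \<star> k} = 4"
      using generative_distinct[OF two_lines(1)] by auto
    moreover have "{{x, y}, {x, x \<star> y}, {x, k}, {x, x \<star> k}}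
        = {{x, y}, {x, k}, {x, x \<star> y}, {x, k \<star> x}}"
      using generative_idx(3)[OF two_lines(1)] fano_op_commute[of x k] by auto
    ultimately show ?thesis
      using that(2) two_lines generative_xy_iff Int_X_eq card_Int_X by auto
  next
    case all
    then show ?thesis
      using that(3) Int_X_eq card_Int_X card_X_point[OF x_idx] by (simp add: X_point_eq)
  qed
qed

lemma Int_X_cases_loop:
  assumes loop: "s \<in> idx - {x}" "{s} \<in> T"
  obtains (line) "card (T \<inter> X) = 3" "T \<inter> X = X_line (line_through x y)"
  | (meeting) "card (T \<inter> X) = 15"
      "\<exists>s\<in>idx - {x}. T \<inter> X = X - X_line_compl (line_through x s)"
  | (all) "card (T \<inter> X) = 21" "T \<inter> X = X"
proof (cases "crossing_free")
  case False
  then obtain i j where "generative x i j" "{i, j} \<in> T"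
    unfolding crossing_free_def by blast
  with loop show ?thesis
  proof (cases rule: Int_X_cases_loop_crossing)
    case meeting
    have "card (X - X_line_compl (line_through x s)) = 15"
      using loop(1) by (intro card_X_Diff_X_line_compl) auto
    with meeting loop(1) show ?thesis
      using that(2) by auto
  next
    case all
    then show ?thesis
      using that(3) card_X by simp
  qed
next
  case True
  have "{s, y} \<in> T"
    using loopD[OF loop(2) base_mem(4)] .
  then have "\<not> generative x s y"
    using True unfolding crossing_free_def by blast
  then have "y = s \<or> y = x \<star> s"
    using loop(1) x_neq_y by (auto simp: generative_iff line_through_def)
  then have "{y} \<in> T"
    using loop by (auto simp: loop_x_op_iff)
  then have "T \<inter> X = X_line (line_through x y)"
    using Int_X_eq_X_line True by blast
  then show ?thesis
    using line card_X_line[OF x_idx y_idx x_neq_y] by simp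
qed

lemma card_XE_Int: "card (T \<inter> XE) = card {s \<in> idx0. {s} \<in> T}"
proof -
  have "T \<inter> XE = (\<lambda>s. {s}) ` {s \<in> idx0. {s} \<in> T}"
    unfolding XE_def by auto
  then show ?thesis
    by (simp add: card_image)
qed

lemma card_XE_Int_eq_2_iff: "card (T \<inter> XE) = 2 \<longleftrightarrow> loop_free"
proof -
  let ?L = "{s \<in> idx - {x}. {s} \<in> T}"
  have "x \<noteq> 0"
    using x_idx zero_notin_idx by metis
  have "{s \<in> idx0. {s} \<in> T} = {0, x} \<union> ?L"
    using base_mem(1,2) unfolding idx0_eq by auto
  moreover have "card ({0, x} \<union> ?L) = card {0, x} + card ?L"
    by (rule card_Un_disjoint) auto
  ultimately have "card (T \<inter> XE) = 2 + card ?L"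
    using \<open>x \<noteq> 0\<close> by (simp add: card_XE_Int)
  then show ?thesis
    by (auto simp: loop_free_def)
qed

end

theorem theorem5p6:
  fixes T :: "nat set set"
  assumes "gen_nice T"
    and "gen_nice_hull (P_set 1 2 1) \<subseteq> T"
  shows
    "(card (T \<inter> XE) = 2 \<longrightarrow>
        card (T \<inter> X) \<in> {2, 4, 6, 10} \<and>
        (card (T \<inter> X) = 2 \<longrightarrow> T \<inter> X = {{1, 2}, {1, 5}}) \<and>
        (card (T \<inter> X) = 4 \<longrightarrow>
          (\<exists>k\<in>{3, 4, 6, 7}. T \<inter> X = {{1, 2}, {1, k}, {1, 5}, {1, k \<star> 1}})) \<and>
        (card (T \<inter> X) = 6 \<longrightarrow>
          T \<inter> X = X_point 1 \<and> X_point 1 = {{1, l} | l. l \<in> {2..7}}) \<and>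
        (card (T \<inter> X) = 10 \<longrightarrow>
          (\<exists>j\<in>{2, 5}. \<exists>k\<in>{3, 4, 6, 7}.
            T \<inter> X = T_set 1 j k \<or> T \<inter> X = T_set 1 (j \<star> k) k)))
     \<and>
     (card (T \<inter> XE) > 2 \<longrightarrow>
        card (T \<inter> X) \<in> {3, 15, 21} \<and>
        (card (T \<inter> X) = 3 \<longrightarrow> T \<inter> X = X_line (line_through 1 2)) \<and>
        (card (T \<inter> X) = 15 \<longrightarrow>
          (\<exists>s\<in>idx - {1}. T \<inter> X = X - X_line_compl (line_through 1 s))) \<and>
        (card (T \<inter> X) = 21 \<longrightarrow> T \<inter> X = X))"
    (is "(?two_loops \<longrightarrow> ?two) \<and> (?more_loops \<longrightarrow> ?more)")
proof (intro conjI[of "?two_loops \<longrightarrow> ?two"] impI)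
  interpret gen_nice_above_P T 1 2
    using assms subset_gen_nice_hull by unfold_locales (auto simp: idx_eq)
  have off_line: "idx - line_through 1 2 = {3, 4, 6, 7}"
    unfolding idx_eq line_through_def by (simp add: fano_op_table insert_Diff_if)
  have point: "X_point 1 = {{1, l} | l. l \<in> {2..7}}"
    unfolding X_point_eq[OF x_idx] by (auto simp: idx_def)
  show ?two if ?two_loops
    using that unfolding card_XE_Int_eq_2_iff
    by (cases rule: Int_X_cases_loop_free)
      (simp_all add: off_line point fano_op_table(1) doubleton_eq_iff)
  show ?more if ?more_loops
  proof -
    from that obtain s where "s \<in> idx - {1}" "{s} \<in> T"
      using card_XE_Int_eq_2_iff unfolding loop_free_def by force
    then show ?more
      by (cases rule: Int_X_cases_loop) auto
  qed
qed

end
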